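(* Let $0<t\le 1$. For each $n$ let $s=[tn]$ be the integer part of $tn$, and regard $u_{11}+\ldots+u_{ss}$ as a real random variable on the hyperoctahedral group $H_n\subset O_n$ equipped with its normalized counting measure. Then, as $n\to\infty$, the law of $u_{11}+\ldots+u_{ss}$ converges to the probability measure $$\beta_t=e^{-t}\sum_{k=-\infty}^\infty\delta_k\sum_{p=0}^\infty\frac{(t/2)^{|k|+2p}}{(|k|+p)!\,p!},$$ where $\delta_k$ is the Dirac mass at $k\in\mathbb Z$.
   Context: $H_n\subset O_n$ is the hyperoctahedral group: the symmetry group of the cube in $\mathbb R^n$, equivalently the group of orthogonal matrices permuting the set of the $\pm1$ points on the $n$ coordinate axes (signed permutation matrices). For $g\in H_n$, $u_{ij}(g)$ denotes the $(i,j)$ entry of the $n\times n$ matrix $g$. Thus $u_{ii}(g)$ is $0$ if $g$ moves the $i$-th axis segment, $+1$ if $g$ fixes it pointwise, and $-1$ if $g$ reverses it. *)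

theory Defs
  imports "HOL-Probability.Probability" "Jordan_Normal_Form.Matrix"
begin

text \<open>The predicate \<open>orthogonal_mat\<close> of Jordan_Normal_Form only asks for pairwise orthogonal
  nonzero columns, so \<open>O\<^sub>n\<close> is defined here by \<open>A\<^sup>T A = 1\<close>.\<close>

definition orthogonal_group :: "nat \<Rightarrow> real mat set" where
  "orthogonal_group n = {A \<in> carrier_mat n n. transpose_mat A * A = 1\<^sub>m n}"

definition axis_points :: "nat \<Rightarrow> real vec set" where
  "axis_points n = {v. \<exists>i<n. v = unit_vec n i \<or> v = - unit_vec n i}"

definition hyperoctahedral_group :: "nat \<Rightarrow> real mat set" where
  "hyperoctahedral_group n =
     {g \<in> orthogonal_group n. bij_betw (\<lambda>v. g *\<^sub>v v) (axis_points n) (axis_points n)}"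

text \<open>Matrix indices start at \<open>0\<close>, so \<open>u\<^sub>1\<^sub>1 + \<dots> + u\<^sub>s\<^sub>s\<close> is the sum
  of the diagonal entries with index \<open>i < s\<close>.\<close>

definition truncated_character :: "nat \<Rightarrow> real mat \<Rightarrow> real" where
  "truncated_character s g = (\<Sum>i<s. g $$ (i, i))"

definition beta_weight :: "real \<Rightarrow> int \<Rightarrow> real" where
  "beta_weight t k = exp (- t) *
     (\<Sum>p. (t / 2) ^ (nat \<bar>k\<bar> + 2 * p) / (fact (nat \<bar>k\<bar> + p) * fact p))"

text \<open>The measure \<open>\<Sum>k. beta_weight t k \<cdot> \<delta>\<^sub>k\<close>, built as the image on the real
  line of a weighted counting measure on the integers; \<open>emeasure_beta_measure\<close> below recovers
  the sum of Dirac masses, as an integral over the counting measure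
  (\<open>return borel x\<close> is the Dirac mass at \<open>x\<close>).\<close>

definition beta_measure :: "real \<Rightarrow> real measure" where
  "beta_measure t = distr (density (count_space UNIV) (\<lambda>k. ennreal (beta_weight t k)))
     borel real_of_int"

lemma emeasure_beta_measure:
  assumes "B \<in> sets borel"
  shows "emeasure (beta_measure t) B =
    (\<integral>\<^sup>+k. ennreal (beta_weight t k) * emeasure (return borel (real_of_int k)) B
       \<partial>count_space UNIV)"
  using assms unfolding beta_measure_def
  by (subst emeasure_distr)
     (auto simp: emeasure_density emeasure_return indicator_def intro!: nn_integral_cong)

end

theory Submission
  imports Defs
begin

text \<open>A random element of \<open>H\<^sub>n\<close> is a uniform permutation with independent uniform signs. Averaging
  \<open>exp (i \<theta> u)\<close> over the signs turns each fixed point below \<open>s\<close> into a factor \<open>cos \<theta>\<close>; writing this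
  factor as \<open>1 + (cos \<theta> - 1)\<close> and expanding over the sets of points required to be fixed gives
  the characteristic function \<open>\<Sum>k\<le>s. (s choose k) (n - k)! / n! (cos \<theta> - 1)\<^sup>k\<close>. Its terms are
  bounded by \<open>\<bar>cos \<theta> - 1\<bar>\<^sup>k / k!\<close>, so for \<open>s / n\<close> tending to \<open>t\<close> it tends to \<open>exp (t (cos \<theta> - 1))\<close>.
  That is the characteristic function of the difference of two independent Poisson variables of
  parameter \<open>t / 2\<close>, whose law is \<open>\<beta>\<^sub>t\<close>; Levy's continuity theorem concludes.\<close>

subsection \<open>Elements of the hyperoctahedral group\<close>

text \<open>The signs form an extensional function space, and a permutation of \<open>{..<n}\<close>
  is the identity elsewhere. Each matrix then comes from exactly one pair, so that the group can be
  counted and summed over through these pairs.\<close>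

definition signed_perms :: "nat \<Rightarrow> ((nat \<Rightarrow> nat) \<times> (nat \<Rightarrow> real)) set" where
  "signed_perms n = {\<sigma>. \<sigma> permutes {..<n}} \<times> ({..<n} \<rightarrow>\<^sub>E {-1, 1})"

definition signed_perm_mat :: "nat \<Rightarrow> (nat \<Rightarrow> nat) \<times> (nat \<Rightarrow> real) \<Rightarrow> real mat" where
  "signed_perm_mat n = (\<lambda>(\<sigma>, \<epsilon>). mat n n (\<lambda>(i, j). if i = \<sigma> j then \<epsilon> j else 0))"

lemma signed_perm_mat_carrier [simp]: "signed_perm_mat n p \<in> carrier_mat n n"
  by (cases p) (simp add: signed_perm_mat_def)

lemma signed_perm_mat_dim [simp]:
  "dim_row (signed_perm_mat n p) = n" "dim_col (signed_perm_mat n p) = n"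
  by (cases p; simp add: signed_perm_mat_def)+

lemma signed_perm_mat_index [simp]:
  "i < n \<Longrightarrow> j < n \<Longrightarrow> signed_perm_mat n (\<sigma>, \<epsilon>) $$ (i, j) = (if i = \<sigma> j then \<epsilon> j else 0)"
  by (simp add: signed_perm_mat_def)

text \<open>The only nonzero entry of column \<open>j\<close> stands in row
  \<open>\<sigma> j\<close> and equals \<open>\<epsilon> j\<close>, so the matrix determines both on
  \<open>{..<n}\<close>; outside, both functions take their fixed default values.\<close>

lemma inj_on_signed_perm_mat: "inj_on (signed_perm_mat n) (signed_perms n)"
proof (rule inj_onI, clarify)
  fix \<sigma> \<epsilon> \<tau> \<delta>
  assume *: "(\<sigma>, \<epsilon>) \<in> signed_perms n" "(\<tau>, \<delta>) \<in> signed_perms n"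
    and eq: "signed_perm_mat n (\<sigma>, \<epsilon>) = signed_perm_mat n (\<tau>, \<delta>)"
  from * have \<sigma>: "\<sigma> permutes {..<n}" and \<tau>: "\<tau> permutes {..<n}"
    and \<epsilon>: "\<epsilon> \<in> {..<n} \<rightarrow>\<^sub>E {-1, 1}" and \<delta>: "\<delta> \<in> {..<n} \<rightarrow>\<^sub>E {-1, 1}"
    by (auto simp: signed_perms_def)
  have same: "\<sigma> j = \<tau> j \<and> \<epsilon> j = \<delta> j" if "j < n" for j
  proof -
    have "\<sigma> j < n" using permutes_in_image[OF \<sigma>, of j] that by simp
    then have "\<epsilon> j = (if \<sigma> j = \<tau> j then \<delta> j else 0)"
      using arg_cong[OF eq, of "\<lambda>A. A $$ (\<sigma> j, j)"] that by simp
    moreover have "\<epsilon> j \<noteq> 0" using PiE_mem[OF \<epsilon>, of j] that by auto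
    ultimately show ?thesis by (auto split: if_splits)
  qed
  have "\<sigma> j = \<tau> j" for j
    using same[of j] permutes_not_in[OF \<sigma>, of j] permutes_not_in[OF \<tau>, of j]
    by (cases "j < n") auto
  moreover have "\<epsilon> = \<delta>" using \<epsilon> \<delta> by (rule PiE_ext) (use same in auto)
  ultimately show "\<sigma> = \<tau> \<and> \<epsilon> = \<delta>" by auto
qed

lemma axis_points_carrier: "v \<in> axis_points n \<Longrightarrow> v \<in> carrier_vec n"
  by (auto simp: axis_points_def)

lemma finite_axis_points: "finite (axis_points n)"
proof (rule finite_subset)
  show "axis_points n \<subseteq> unit_vec n ` {..<n} \<union> (\<lambda>i. - unit_vec n i) ` {..<n}"
    by (auto simp: axis_points_def)
qed auto

lemma signed_perm_mat_mult_unit_vec: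
  assumes "\<sigma> permutes {..<n}" and "j < n"
  shows "signed_perm_mat n (\<sigma>, \<epsilon>) *\<^sub>v unit_vec n j = \<epsilon> j \<cdot>\<^sub>v unit_vec n (\<sigma> j)"
proof (rule eq_vecI)
  fix i assume "i < dim_vec (\<epsilon> j \<cdot>\<^sub>v unit_vec n (\<sigma> j))"
  then have i: "i < n" by simp
  moreover have "\<sigma> j < n" using permutes_in_image[OF assms(1), of j] assms(2) by simp
  ultimately show "(signed_perm_mat n (\<sigma>, \<epsilon>) *\<^sub>v unit_vec n j) $ i = (\<epsilon> j \<cdot>\<^sub>v unit_vec n (\<sigma> j)) $ i"
    using assms(2) by simp
qed simp

text \<open>Distinct columns have disjoint supports because \<sigma> is injective, and each has norm
  1; this is orthogonality. The transpose is then a left inverse, so the action is injective, and an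
  injective map of the finite set of axis points into itself is bijective.\<close>

lemma signed_perm_mat_in_hyperoctahedral_group:
  assumes "(\<sigma>, \<epsilon>) \<in> signed_perms n"
  shows "signed_perm_mat n (\<sigma>, \<epsilon>) \<in> hyperoctahedral_group n"
proof -
  let ?M = "signed_perm_mat n (\<sigma>, \<epsilon>)"
  from assms have \<sigma>: "\<sigma> permutes {..<n}" and \<epsilon>: "\<epsilon> \<in> {..<n} \<rightarrow>\<^sub>E {-1, 1}"
    by (auto simp: signed_perms_def)
  have \<epsilon>_cases: "\<epsilon> j = -1 \<or> \<epsilon> j = 1" if "j < n" for j
    using PiE_mem[OF \<epsilon>, of j] that by auto
  have orth: "transpose_mat ?M * ?M = 1\<^sub>m n"
  proof (rule eq_matI)
    fix i j assume "i < dim_row (1\<^sub>m n :: real mat)" "j < dim_col (1\<^sub>m n :: real mat)"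
    then have ij: "i < n" "j < n" by auto
    then have \<sigma>i: "\<sigma> i < n" using permutes_in_image[OF \<sigma>, of i] by simp
    have "(transpose_mat ?M * ?M) $$ (i, j) = (\<Sum>k = 0..<n. ?M $$ (k, i) * ?M $$ (k, j))"
      using ij by (simp add: scalar_prod_def)
    also have "\<dots> = (\<Sum>k = 0..<n. if k = \<sigma> i then (if \<sigma> i = \<sigma> j then \<epsilon> i * \<epsilon> j else 0) else 0)"
      using ij by (intro sum.cong) auto
    also have "\<dots> = (if \<sigma> i = \<sigma> j then \<epsilon> i * \<epsilon> j else 0)" using \<sigma>i by simp
    also have "\<dots> = (if i = j then 1 else 0)"
      using \<epsilon>_cases[OF ij(1)] inj_eq[OF permutes_inj[OF \<sigma>]] by auto
    finally show "(transpose_mat ?M * ?M) $$ (i, j) = 1\<^sub>m n $$ (i, j)" using ij by simp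
  qed auto
  have "inj_on (\<lambda>v. ?M *\<^sub>v v) (axis_points n)"
  proof (rule inj_onI)
    fix v w assume vw: "v \<in> axis_points n" "w \<in> axis_points n" "?M *\<^sub>v v = ?M *\<^sub>v w"
    have "u = transpose_mat ?M *\<^sub>v (?M *\<^sub>v u)" if "u \<in> carrier_vec n" for u
      using that orth assoc_mult_mat_vec[of "transpose_mat ?M" n n ?M n u]
      by (simp add: transpose_carrier_mat)
    then show "v = w" using vw axis_points_carrier by metis
  qed
  moreover have "(\<lambda>v. ?M *\<^sub>v v) ` axis_points n \<subseteq> axis_points n"
  proof clarify
    fix v assume "v \<in> axis_points n"
    then obtain j where j: "j < n" "v = unit_vec n j \<or> v = - unit_vec n j"
      by (auto simp: axis_points_def)
    have "\<sigma> j < n" using permutes_in_image[OF \<sigma>, of j] j by simp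
    moreover have "?M *\<^sub>v (- unit_vec n j) = - (?M *\<^sub>v unit_vec n j)"
      using j by (intro eq_vecI) (auto simp: scalar_prod_right_unit[of _ n] scalar_prod_uminus_right[of _ "unit_vec n j"])
    ultimately show "?M *\<^sub>v v \<in> axis_points n"
      using j \<epsilon>_cases[OF j(1)] signed_perm_mat_mult_unit_vec[OF \<sigma> j(1), of \<epsilon>]
      by (auto simp: axis_points_def intro!: exI[of _ "\<sigma> j"])
  qed
  ultimately have "bij_betw (\<lambda>v. ?M *\<^sub>v v) (axis_points n) (axis_points n)"
    using endo_inj_surj[OF finite_axis_points] by (auto simp: bij_betw_def)
  then show ?thesis using orth by (simp add: hyperoctahedral_group_def orthogonal_group_def)
qed

text \<open>The image of a unit vector is the corresponding column, so each column is plus or minus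
  a unit vector. If two columns had the same support, their scalar product would be 1 or -1 instead
  of 0; hence the map of indices is injective, and a permutation by finiteness.\<close>

lemma hyperoctahedral_group_imp_signed_perm_mat:
  assumes "g \<in> hyperoctahedral_group n"
  shows "g \<in> signed_perm_mat n ` signed_perms n"
proof -
  from assms have g: "g \<in> carrier_mat n n" and orth: "transpose_mat g * g = 1\<^sub>m n"
    and bij: "bij_betw (\<lambda>v. g *\<^sub>v v) (axis_points n) (axis_points n)"
    by (auto simp: hyperoctahedral_group_def orthogonal_group_def)
  have "\<exists>i e. i < n \<and> e \<in> {-1, 1} \<and> (\<forall>k<n. g $$ (k, j) = (if k = i then e else 0))" if j: "j < n" for j
  proof -
    have "g *\<^sub>v unit_vec n j \<in> axis_points n"
      using bij_betwE[OF bij] j by (auto simp: axis_points_def)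
    then obtain i where i: "i < n" "g *\<^sub>v unit_vec n j = unit_vec n i \<or> g *\<^sub>v unit_vec n j = - unit_vec n i"
      by (auto simp: axis_points_def)
    have "g $$ (k, j) = (g *\<^sub>v unit_vec n j) $ k" if "k < n" for k
      using g j that by (auto simp: scalar_prod_right_unit[of _ n])
    with i show ?thesis
      by (intro exI[of _ i] exI[of _ "if g *\<^sub>v unit_vec n j = unit_vec n i then 1 else -1"]) auto
  qed
  then obtain \<sigma>' \<epsilon>' where \<sigma>': "\<And>j. j < n \<Longrightarrow> \<sigma>' j < n" and \<epsilon>': "\<And>j. j < n \<Longrightarrow> \<epsilon>' j \<in> {-1, 1::real}"
    and entries: "\<And>j k. j < n \<Longrightarrow> k < n \<Longrightarrow> g $$ (k, j) = (if k = \<sigma>' j then \<epsilon>' j else 0)"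
    by metis
  \<comment> \<open>The chosen functions are arbitrary from \<open>n\<close> on; they are normalised
    there to meet the conventions of \<open>signed_perms\<close>.\<close>
  define \<sigma> where "\<sigma> j = (if j < n then \<sigma>' j else j)" for j
  define \<epsilon> where "\<epsilon> = restrict \<epsilon>' {..<n}"
  have inj: "inj_on \<sigma> {..<n}"
  proof (rule inj_onI, rule ccontr)
    fix i j assume ij: "i \<in> {..<n}" "j \<in> {..<n}" "\<sigma> i = \<sigma> j" "i \<noteq> j"
    have "0 = (transpose_mat g * g) $$ (i, j)" using ij orth by simp
    also have "\<dots> = (\<Sum>k = 0..<n. g $$ (k, i) * g $$ (k, j))"
      using ij g by (simp add: scalar_prod_def)
    also have "\<dots> = (\<Sum>k = 0..<n. if k = \<sigma> i then \<epsilon>' i * \<epsilon>' j else 0)"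
      using ij by (intro sum.cong) (auto simp: entries \<sigma>_def)
    also have "\<dots> = \<epsilon>' i * \<epsilon>' j" using ij \<sigma>'[of i] by (simp add: \<sigma>_def)
    finally show False using \<epsilon>'[of i] \<epsilon>'[of j] ij by auto
  qed
  have "\<sigma> ` {..<n} \<subseteq> {..<n}" using \<sigma>' by (auto simp: \<sigma>_def)
  then have "\<sigma> permutes {..<n}"
    using endo_inj_surj[OF _ _ inj] inj
    by (intro bij_imp_permutes) (auto simp: bij_betw_def \<sigma>_def)
  then have "(\<sigma>, \<epsilon>) \<in> signed_perms n" using \<epsilon>' by (auto simp: signed_perms_def \<epsilon>_def)
  moreover have "g = signed_perm_mat n (\<sigma>, \<epsilon>)"
    using g by (intro eq_matI) (auto simp: entries \<sigma>_def \<epsilon>_def)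
  ultimately show ?thesis by blast
qed

lemma bij_betw_signed_perm_mat:
  "bij_betw (signed_perm_mat n) (signed_perms n) (hyperoctahedral_group n)"
  using inj_on_signed_perm_mat signed_perm_mat_in_hyperoctahedral_group
    hyperoctahedral_group_imp_signed_perm_mat
  by (fastforce simp: bij_betw_def)

lemma card_signed_perms: "card (signed_perms n) = fact n * 2 ^ n"
  by (simp add: signed_perms_def card_cartesian_product card_permutations card_PiE numeral_2_eq_2)

lemma finite_signed_perms: "finite (signed_perms n)"
  by (auto simp: signed_perms_def intro!: finite_cartesian_product finite_permutations finite_PiE)

lemma finite_hyperoctahedral_group: "finite (hyperoctahedral_group n)"
  using bij_betw_finite[OF bij_betw_signed_perm_mat] finite_signed_perms by blast

lemma card_hyperoctahedral_group: "card (hyperoctahedral_group n) = fact n * 2 ^ n"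
  using bij_betw_same_card[OF bij_betw_signed_perm_mat] card_signed_perms by metis

lemma hyperoctahedral_group_nonempty: "hyperoctahedral_group n \<noteq> {}"
  using card_hyperoctahedral_group[of n] by auto

lemma truncated_character_signed_perm_mat:
  assumes "s \<le> n"
  shows "truncated_character s (signed_perm_mat n (\<sigma>, \<epsilon>)) = (\<Sum>i<s. if \<sigma> i = i then \<epsilon> i else 0)"
  using assms by (auto simp: truncated_character_def intro!: sum.cong)

subsection \<open>The characteristic function of the truncated character\<close>

text \<open>Independence of the signs: the exponential of the sum is a product over coordinates, and
  summing over all sign vectors turns it into a product of two-term sums. Such a sum is exp
  (i\<theta>) + exp (-i\<theta>) = 2 cos \<theta> at a counted coordinate and 1 + 1 = 2 at any
  other.\<close>

lemma sum_signs_iexp: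
  assumes "s \<le> n"
  shows "(\<Sum>\<epsilon>\<in>{..<n} \<rightarrow>\<^sub>E {-1, 1::real}. iexp (\<theta> * (\<Sum>i<s. if P i then \<epsilon> i else 0))) =
    2 ^ n * (\<Prod>i<s. if P i then complex_of_real (cos \<theta>) else 1)"
proof -
  \<comment> \<open>Padding with the factor 1 extends the product from \<open>{..<s}\<close> to
    \<open>{..<n}\<close>, the index set of the sign vectors.\<close>
  define f where "f i e = (if i < s \<and> P i then iexp (\<theta> * e) else 1)" for i e
  have "iexp (\<theta> * (\<Sum>i<s. if P i then \<epsilon> i else 0)) = (\<Prod>i<n. f i (\<epsilon> i))" for \<epsilon>
  proof -
    have "iexp (\<theta> * (\<Sum>i<s. if P i then \<epsilon> i else 0)) = (\<Prod>i<s. iexp (\<theta> * (if P i then \<epsilon> i else 0)))"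
      by (simp add: sum_distrib_left exp_sum[symmetric])
    also have "\<dots> = (\<Prod>i<s. f i (\<epsilon> i))" by (intro prod.cong) (auto simp: f_def)
    also have "\<dots> = (\<Prod>i<n. f i (\<epsilon> i))"
      using assms by (intro prod.mono_neutral_left) (auto simp: f_def)
    finally show ?thesis .
  qed
  then have "(\<Sum>\<epsilon>\<in>{..<n} \<rightarrow>\<^sub>E {-1, 1::real}. iexp (\<theta> * (\<Sum>i<s. if P i then \<epsilon> i else 0))) =
      (\<Sum>\<epsilon>\<in>{..<n} \<rightarrow>\<^sub>E {-1, 1::real}. \<Prod>i<n. f i (\<epsilon> i))" by simp
  also have "\<dots> = (\<Prod>i<n. \<Sum>e\<in>{-1, 1}. f i e)" by (rule prod_sum_PiE[symmetric]) auto
  also have "\<dots> = (\<Prod>i<n. 2 * (if i < s \<and> P i then complex_of_real (cos \<theta>) else 1))"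
    by (intro prod.cong)
      (auto simp: f_def complex_eq_iff Re_exp Im_exp)
  also have "\<dots> = 2 ^ n * (\<Prod>i<n. if i < s \<and> P i then complex_of_real (cos \<theta>) else 1)"
    by (simp add: prod.distrib)
  also have "(\<Prod>i<n. if i < s \<and> P i then complex_of_real (cos \<theta>) else 1) =
      (\<Prod>i<s. if P i then complex_of_real (cos \<theta>) else 1)"
    using assms by (intro prod.mono_neutral_cong_right) auto
  finally show ?thesis .
qed

text \<open>Permutations of \<open>S\<close> that fix \<open>A\<close> pointwise are the
  permutations of \<open>S - A\<close>.\<close>

lemma card_permutes_fixing:
  assumes "finite S" and "A \<subseteq> S"
  shows "card {\<sigma>. \<sigma> permutes S \<and> (\<forall>a\<in>A. \<sigma> a = a)} = fact (card S - card A)"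
proof -
  have "{\<sigma>. \<sigma> permutes S \<and> (\<forall>a\<in>A. \<sigma> a = a)} = {\<sigma>. \<sigma> permutes (S - A)}"
    using permutes_subset[of _ "S - A" S]
    by (auto intro: permutes_superset dest: permutes_not_in)
  then show ?thesis
    using assms by (simp add: card_permutations card_Diff_subset finite_subset)
qed

text \<open>After the expansion, a set \<open>A\<close> only prescribes some fixed points, and
  others are allowed. So each \<open>A\<close> with \<open>k\<close> elements is counted by (n - k)!
  permutations, and no count by the exact number of fixed points is required.\<close>

lemma sum_permutes_prod_fixed:
  fixes c :: "'a :: {comm_ring_1, semiring_char_0}"
  assumes "s \<le> n"
  shows "(\<Sum>\<sigma> | \<sigma> permutes {..<n}. \<Prod>i<s. if \<sigma> i = i then c else 1) =
    (\<Sum>k\<le>s. of_nat (s choose k) * (c - 1) ^ k * fact (n - k))"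
proof -
  let ?P = "{\<sigma>. \<sigma> permutes {..<n}}"
  have fin: "finite ?P" by (rule finite_permutations) simp
  have "(\<Prod>i<s. if \<sigma> i = i then c else 1) =
      (\<Sum>A\<in>Pow {..<s}. if \<forall>a\<in>A. \<sigma> a = a then (c - 1) ^ card A else 0)" for \<sigma> :: "nat \<Rightarrow> nat"
  proof -
    have "(\<Prod>i<s. if \<sigma> i = i then c else 1) = (\<Prod>i<s. (if \<sigma> i = i then c - 1 else 0) + 1)"
      by (intro prod.cong) auto
    also have "\<dots> = (\<Sum>A\<in>Pow {..<s}. \<Prod>i\<in>A. if \<sigma> i = i then c - 1 else 0)"
      by (subst prod_add) auto
    also have "\<dots> = (\<Sum>A\<in>Pow {..<s}. if \<forall>a\<in>A. \<sigma> a = a then (c - 1) ^ card A else 0)"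
      \<comment> \<open>A single moved point of \<open>A\<close> makes the product over
        \<open>A\<close> vanish.\<close>
      by (intro sum.cong refl) (auto intro!: prod_zero dest: finite_subset)
    finally show ?thesis .
  qed
  then have "(\<Sum>\<sigma>\<in>?P. \<Prod>i<s. if \<sigma> i = i then c else 1) =
      (\<Sum>A\<in>Pow {..<s}. \<Sum>\<sigma>\<in>?P. if \<forall>a\<in>A. \<sigma> a = a then (c - 1) ^ card A else 0)"
    by (simp add: sum.swap[of _ _ ?P])
  also have "\<dots> = (\<Sum>A\<in>Pow {..<s}. (c - 1) ^ card A * fact (n - card A))"
  proof (intro sum.cong refl)
    fix A assume "A \<in> Pow {..<s}"
    then have "A \<subseteq> {..<n}" using assms by auto
    then have "card {\<sigma> \<in> ?P. \<forall>a\<in>A. \<sigma> a = a} = fact (n - card A)"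
      using card_permutes_fixing[of "{..<n}" A] by simp
    then have "of_nat (card {\<sigma> \<in> ?P. \<forall>a\<in>A. \<sigma> a = a}) = (fact (n - card A) :: 'a)"
      by (metis of_nat_fact)
    then show "(\<Sum>\<sigma>\<in>?P. if \<forall>a\<in>A. \<sigma> a = a then (c - 1) ^ card A else 0) =
        (c - 1) ^ card A * fact (n - card A)"
      using sum.inter_filter[OF fin, of "\<lambda>_. (c - 1) ^ card A" "\<lambda>\<sigma>. \<forall>a\<in>A. \<sigma> a = a"]
      by (simp add: mult.commute)
  qed
  also have "\<dots> = (\<Sum>k\<le>s. \<Sum>A | A \<in> Pow {..<s} \<and> card A = k. (c - 1) ^ card A * fact (n - card A))"
    by (rule sum.group[symmetric])
      (auto intro: card_mono[of "{..<s}", simplified])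
  also have "\<dots> = (\<Sum>k\<le>s. of_nat (s choose k) * (c - 1) ^ k * fact (n - k))"
    by (intro sum.cong refl) (simp add: n_subsets mult.assoc)
  finally show ?thesis .
qed

text \<open>The mean over the group is a sum over pairs (\<sigma>, \<epsilon>), taken first over
  \<epsilon> with \<sigma> fixed. The resulting factor \<open>2 ^ n\<close> cancels against the
  group order \<open>fact n * 2 ^ n\<close>.\<close>

lemma char_truncated_character:
  assumes "s \<le> n"
  shows "char (distr (uniform_count_measure (hyperoctahedral_group n)) borel (truncated_character s)) \<theta> =
    (\<Sum>k\<le>s. of_real (real (s choose k) * fact (n - k) / fact n * (cos \<theta> - 1) ^ k))"
proof -
  let ?H = "hyperoctahedral_group n"
  have "char (distr (uniform_count_measure ?H) borel (truncated_character s)) \<theta> =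
      (CLINT g|uniform_count_measure ?H. iexp (\<theta> * truncated_character s g))"
    unfolding char_def by (subst integral_distr) (auto simp: uniform_count_measure_def)
  also have "\<dots> = (\<Sum>g\<in>?H. iexp (\<theta> * truncated_character s g)) / (fact n * 2 ^ n)"
    by (simp add: uniform_count_measure_def lebesgue_integral_point_measure_finite
        finite_hyperoctahedral_group card_hyperoctahedral_group scaleR_conv_of_real sum_divide_distrib)
  also have "(\<Sum>g\<in>?H. iexp (\<theta> * truncated_character s g)) =
      (\<Sum>(\<sigma>, \<epsilon>)\<in>signed_perms n. iexp (\<theta> * (\<Sum>i<s. if \<sigma> i = i then \<epsilon> i else 0)))"
    by (subst sum.reindex_bij_betw[OF bij_betw_signed_perm_mat, symmetric])
      (auto simp: truncated_character_signed_perm_mat[OF assms] intro!: sum.cong)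
  also have "\<dots> = (\<Sum>\<sigma> | \<sigma> permutes {..<n}. 2 ^ n * (\<Prod>i<s. if \<sigma> i = i then complex_of_real (cos \<theta>) else 1))"
    unfolding signed_perms_def
    by (subst sum.cartesian_product[symmetric]) (simp only: sum_signs_iexp[OF assms])
  also have "\<dots> = 2 ^ n * (\<Sum>k\<le>s. of_nat (s choose k) * (complex_of_real (cos \<theta>) - 1) ^ k * fact (n - k))"
    by (simp only: sum_distrib_left[symmetric] sum_permutes_prod_fixed[OF assms])
  finally show ?thesis
    by (simp add: sum_divide_distrib sum_distrib_left mult_ac)
qed

subsection \<open>The limit law as a difference of Poisson variables\<close>

text \<open>Turns expectations into unordered sums, for which a Fubini rule and the passage to
  series on the naturals are at hand.\<close>

lemma pmf_expectation_eq_infsetsum: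
  fixes f :: "'a \<Rightarrow> 'b :: {banach, second_countable_topology}"
  shows "measure_pmf.expectation p f = infsetsum (\<lambda>x. pmf p x *\<^sub>R f x) UNIV"
  by (simp add: measure_pmf_eq_density integral_density infsetsum_def)

lemma abs_summable_pmf_scaleR:
  fixes f :: "'a \<Rightarrow> 'b :: {banach, second_countable_topology}"
  assumes "\<And>x. norm (f x) \<le> 1"
  shows "Infinite_Set_Sum.abs_summable_on (\<lambda>x. pmf p x *\<^sub>R f x) UNIV"
proof (rule abs_summable_on_comparison_test)
  show "Infinite_Set_Sum.abs_summable_on (pmf p) UNIV" by (rule pmf_abs_summable)
  show "norm (pmf p x *\<^sub>R f x) \<le> norm (pmf p x)" for x
    using mult_left_mono[OF assms[of x] pmf_nonneg[of p x]] by simp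
qed

text \<open>Independence: the bounds on \<open>f\<close> and \<open>g\<close> make the double sum
  absolutely summable, so it may be iterated, and its terms factor.\<close>

lemma expectation_pair_pmf_mult:
  fixes f :: "'a :: countable \<Rightarrow> complex" and g :: "'b :: countable \<Rightarrow> complex"
  assumes f: "\<And>x. norm (f x) \<le> 1" and g: "\<And>y. norm (g y) \<le> 1"
  shows "measure_pmf.expectation (pair_pmf p q) (\<lambda>(x, y). f x * g y) =
    measure_pmf.expectation p f * measure_pmf.expectation q g"
proof -
  let ?h = "\<lambda>z. pmf (pair_pmf p q) z *\<^sub>R (case z of (x, y) \<Rightarrow> f x * g y)"
  have "norm (case z of (x, y) \<Rightarrow> f x * g y) \<le> 1" for z
    using mult_le_one[OF f norm_ge_zero g, of "fst z" "snd z"] by (simp add: case_prod_unfold norm_mult)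
  then have "Infinite_Set_Sum.abs_summable_on ?h (UNIV \<times> UNIV)"
    using abs_summable_pmf_scaleR[of "\<lambda>(x, y). f x * g y" "pair_pmf p q"] by simp
  then have "infsetsum ?h (UNIV \<times> UNIV) =
      infsetsum (\<lambda>x. infsetsum (\<lambda>y. ?h (x, y)) UNIV) UNIV"
    by (intro infsetsum_Times) auto
  also have "\<dots> = infsetsum (\<lambda>x. infsetsum (\<lambda>y. (pmf p x *\<^sub>R f x) * (pmf q y *\<^sub>R g y)) UNIV) UNIV"
    by (simp add: pmf_pair mult_ac)
  also have "\<dots> = infsetsum (\<lambda>x. pmf p x *\<^sub>R f x) UNIV * infsetsum (\<lambda>y. pmf q y *\<^sub>R g y) UNIV"
    using abs_summable_pmf_scaleR[OF f, of p] abs_summable_pmf_scaleR[OF g, of q]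
    by (simp only: infsetsum_cmult_right infsetsum_cmult_left)
  finally show ?thesis by (simp add: pmf_expectation_eq_infsetsum)
qed

lemma expectation_poisson_pmf_iexp:
  assumes "0 < r"
  shows "measure_pmf.expectation (poisson_pmf r) (\<lambda>k. iexp (\<theta> * real k)) =
    exp (of_real r * (iexp \<theta> - 1))"
proof -
  let ?f = "\<lambda>k. pmf (poisson_pmf r) k *\<^sub>R iexp (\<theta> * real k)"
  have "Infinite_Set_Sum.abs_summable_on ?f UNIV"
    by (rule abs_summable_pmf_scaleR) (simp del: of_real_mult)
  then have "?f sums infsetsum ?f UNIV" by (rule sums_infsetsum_nat')
  moreover have "?f sums (exp (- of_real r) * exp (of_real r * iexp \<theta>))"
  proof -
    have "iexp (\<theta> * real k) = iexp \<theta> ^ k" for k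
      by (simp add: exp_of_nat_mult[symmetric] mult_ac)
    then have "?f k = exp (- of_real r) * ((of_real r * iexp \<theta>) ^ k /\<^sub>R fact k)" for k
      using assms by (simp add: scaleR_conv_of_real power_mult_distrib exp_of_real[symmetric] field_simps)
    then show ?thesis
      using sums_mult[OF exp_converges[of "of_real r * iexp \<theta>"], of "exp (- of_real r)"] by simp
  qed
  ultimately have "infsetsum ?f UNIV = exp (- of_real r) * exp (of_real r * iexp \<theta>)"
    by (rule sums_unique2)
  then show ?thesis
    by (simp add: pmf_expectation_eq_infsetsum exp_add[symmetric] algebra_simps)
qed

text \<open>This is the symmetric Skellam law. For \<open>r = t / 2\<close> its weight at
  \<open>k\<close> is exp (-t) times the modified Bessel function of order \<bar>k\<bar> at
  \<open>t\<close>.\<close>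

definition poisson_difference_pmf :: "real \<Rightarrow> int pmf" where
  "poisson_difference_pmf r =
     map_pmf (\<lambda>(a, b). int a - int b) (pair_pmf (poisson_pmf r) (poisson_pmf r))"

text \<open>The pairs with difference \<open>k\<close> are parametrised by their minimum
  \<open>p\<close>, the other component being \<bar>k\<bar> + p. The sign of \<open>k\<close>
  decides which component is larger, but not the product of the two Poisson weights.\<close>

lemma pmf_poisson_difference:
  assumes "0 < t"
  shows "pmf (poisson_difference_pmf (t / 2)) k = beta_weight t k"
proof -
  let ?P = "poisson_pmf (t / 2)" and ?m = "nat \<bar>k\<bar>"
  let ?S = "(\<lambda>(a, b). int a - int b) -` {k}"
  define h where "h p = (if 0 \<le> k then (?m + p, p) else (p, ?m + p))" for p
  have bij: "bij_betw h UNIV ?S"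
  proof (rule bij_betwI[where g = "\<lambda>(a, b). min a b"])
    fix z assume "z \<in> ?S"
    then show "h (case z of (a, b) \<Rightarrow> min a b) = z" by (cases z) (auto simp: h_def)
  qed (auto simp: h_def)
  have h: "pmf (pair_pmf ?P ?P) (h p) =
      exp (- t) * ((t / 2) ^ (?m + 2 * p) / (fact (?m + p) * fact p))" for p
  proof -
    have "exp (- t) = exp (- (t / 2)) * exp (- (t / 2))" by (simp flip: exp_add)
    moreover have "(t / 2) ^ (?m + 2 * p) = (t / 2) ^ (?m + p) * (t / 2) ^ p"
      by (simp add: mult_2 add.assoc flip: power_add)
    ultimately show ?thesis using assms by (simp add: h_def pmf_pair mult_ac)
  qed
  have summable: "Infinite_Set_Sum.abs_summable_on (\<lambda>p. pmf (pair_pmf ?P ?P) (h p)) UNIV"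
    unfolding abs_summable_on_reindex_bij_betw[OF bij] by (rule pmf_abs_summable)
  have "pmf (poisson_difference_pmf (t / 2)) k = infsetsum (pmf (pair_pmf ?P ?P)) ?S"
    by (simp add: poisson_difference_pmf_def pmf_map measure_pmf_conv_infsetsum)
  also have "\<dots> = infsetsum (\<lambda>p. pmf (pair_pmf ?P ?P) (h p)) UNIV"
    by (rule infsetsum_reindex_bij_betw[OF bij, symmetric])
  also have "\<dots> = (\<Sum>p. pmf (pair_pmf ?P ?P) (h p))"
    by (rule infsetsum_nat'[OF summable])
  also have "\<dots> = beta_weight t k"
    unfolding h beta_weight_def
  proof (rule suminf_mult)
    \<comment> \<open>The series of probabilities converges; dividing by the nonzero constant
      \<open>exp (- t)\<close> gives convergence of the Bessel series.\<close>
    have "summable (\<lambda>p. pmf (pair_pmf ?P ?P) (h p))"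
      using sums_infsetsum_nat'[OF summable] by (rule sums_summable)
    then show "summable (\<lambda>p. (t / 2) ^ (?m + 2 * p) / (fact (?m + p) * fact p))"
      unfolding h by (rule summable_mult_D) simp
  qed
  finally show ?thesis .
qed

text \<open>As the image of a probability mass function, the limit measure has total mass 1 without
  any summation of its weights.\<close>

lemma beta_measure_eq_distr:
  assumes "0 < t"
  shows "beta_measure t = distr (poisson_difference_pmf (t / 2)) borel real_of_int"
  unfolding beta_measure_def measure_pmf_eq_density
  by (simp add: pmf_poisson_difference[OF assms])

lemma real_distribution_beta_measure:
  assumes "0 < t"
  shows "real_distribution (beta_measure t)"
  unfolding beta_measure_eq_distr[OF assms]
  by (rule prob_space.real_distribution_distr) (auto intro: prob_space_measure_pmf)

text \<open>By independence this is the product of the Poisson characteristic functions at \<theta>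
  and -\<theta>; in the exponent exp (i\<theta>) and exp (-i\<theta>) add up to 2 cos
  \<theta>.\<close>

lemma char_beta_measure:
  assumes "0 < t"
  shows "char (beta_measure t) \<theta> = of_real (exp (t * (cos \<theta> - 1)))"
proof -
  let ?P = "poisson_pmf (t / 2)"
  have "char (beta_measure t) \<theta> =
      measure_pmf.expectation (poisson_difference_pmf (t / 2)) (\<lambda>k. iexp (\<theta> * real_of_int k))"
    unfolding char_def beta_measure_eq_distr[OF assms] by (subst integral_distr) auto
  also have "\<dots> = measure_pmf.expectation (pair_pmf ?P ?P)
      (\<lambda>(a, b). iexp (\<theta> * real a) * iexp (- \<theta> * real b))"
    by (simp add: poisson_difference_pmf_def case_prod_unfold exp_add[symmetric] algebra_simps)
  also have "\<dots> = exp (of_real (t / 2) * (iexp \<theta> - 1)) * exp (of_real (t / 2) * (iexp (- \<theta>) - 1))"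
    using assms by (subst expectation_pair_pmf_mult)
      (simp_all only: norm_exp_i_times expectation_poisson_pmf_iexp half_gt_zero order_refl)
  also have "\<dots> = exp (of_real (t / 2) * (iexp \<theta> + iexp (- \<theta>) - 2))"
    by (simp add: exp_add[symmetric] algebra_simps)
  also have "iexp \<theta> + iexp (- \<theta>) = 2 * of_real (cos \<theta>)"
    by (simp add: complex_eq_iff Re_exp Im_exp)
  also have "of_real (t / 2) * (2 * of_real (cos \<theta>) - 2) = complex_of_real (t * (cos \<theta> - 1))"
    by (simp add: algebra_simps)
  finally show ?thesis by (simp only: exp_of_real)
qed

subsection \<open>Convergence of the characteristic functions\<close>

lemma tendsto_floor_mult_div:
  fixes t :: real
  assumes "0 < t"
  shows "(\<lambda>n. real (nat \<lfloor>t * real n\<rfloor>) / real n) \<longlonglongrightarrow> t"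
proof (rule tendsto_sandwich[where f = "\<lambda>n. t - 1 / real n" and h = "\<lambda>_. t"])
  show "(\<lambda>n. t - 1 / real n) \<longlonglongrightarrow> t"
    using tendsto_diff[OF tendsto_const[of t] lim_1_over_n] by simp
  have s: "real (nat \<lfloor>t * real n\<rfloor>) = real_of_int \<lfloor>t * real n\<rfloor>" for n using assms by simp
  \<comment> \<open>At \<open>n = 0\<close> division by zero would turn this into t \<le> 0, hence
    the restriction to positive \<open>n\<close>.\<close>
  show "\<forall>\<^sub>F n in sequentially. t - 1 / real n \<le> real (nat \<lfloor>t * real n\<rfloor>) / real n"
    using eventually_gt_at_top[of 0]
  proof eventually_elim
    case (elim n)
    have "t * real n - 1 \<le> real_of_int \<lfloor>t * real n\<rfloor>" by linarith
    then have "(t * real n - 1) / real n \<le> real_of_int \<lfloor>t * real n\<rfloor> / real n"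
      by (intro divide_right_mono) auto
    then show ?case unfolding s using elim by (simp add: diff_divide_distrib)
  qed
  show "\<forall>\<^sub>F n in sequentially. real (nat \<lfloor>t * real n\<rfloor>) / real n \<le> t"
    using eventually_gt_at_top[of 0]
  proof eventually_elim
    case (elim n)
    then show ?case unfolding s by (simp add: field_simps)
  qed
qed simp

text \<open>The quotient is (s choose k) / (n choose k) divided by k!, and the ratio of binomials is
  the product of (s - i) / (n - i) over i < k. For fixed \<open>k\<close> these are finitely many
  factors, each tending to \<open>t\<close>.\<close>

lemma tendsto_binomial_fact_quotient:
  fixes t :: real
  assumes lim: "(\<lambda>n. real (s n) / real n) \<longlonglongrightarrow> t"
  shows "(\<lambda>n. real (s n choose k) * fact (n - k) / fact n) \<longlonglongrightarrow> t ^ k / fact k"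
proof -
  have factor: "(\<lambda>n. (real (s n) - real i) / (real n - real i)) \<longlonglongrightarrow> t" for i
  proof (rule Lim_transform_eventually)
    have "(\<lambda>n. real i / real n) \<longlonglongrightarrow> 0" by (rule lim_const_over_n)
    then show "(\<lambda>n. (real (s n) / real n - real i / real n) / (1 - real i / real n)) \<longlonglongrightarrow> t"
      using tendsto_divide[OF tendsto_diff[OF lim] tendsto_diff[OF tendsto_const[of 1]],
          of "\<lambda>n. real i / real n" 0 "\<lambda>n. real i / real n" 0] by simp
    show "\<forall>\<^sub>F n in sequentially. (real (s n) / real n - real i / real n) / (1 - real i / real n) =
        (real (s n) - real i) / (real n - real i)"
      using eventually_gt_at_top[of 0]
    proof eventually_elim
      case (elim n)
      then have "real (s n) / real n - real i / real n = (real (s n) - real i) / real n"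
        "1 - real i / real n = (real n - real i) / real n"
        by (simp_all add: diff_divide_distrib)
      then show ?case using elim by simp
    qed
  qed
  have "(\<lambda>n. (\<Prod>i = 0..<k. (real (s n) - real i) / (real n - real i)) / fact k) \<longlonglongrightarrow>
      (\<Prod>i = 0..<k. t) / fact k"
    by (intro tendsto_intros factor) auto
  then have "(\<lambda>n. (\<Prod>i = 0..<k. (real (s n) - real i) / (real n - real i)) / fact k) \<longlonglongrightarrow> t ^ k / fact k"
    by simp
  then show ?thesis
  proof (rule Lim_transform_eventually)
    show "\<forall>\<^sub>F n in sequentially. (\<Prod>i = 0..<k. (real (s n) - real i) / (real n - real i)) / fact k =
        real (s n choose k) * fact (n - k) / fact n"
      using eventually_ge_at_top[of k]
    proof eventually_elim
      case (elim n)
      have pos: "real (n choose k) \<noteq> 0" using elim by simp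
      have "fact k * fact (n - k) * real (n choose k) = fact n"
        using arg_cong[OF binomial_fact_lemma[OF elim], of real] by simp
      then have "real (s n choose k) * fact (n - k) / fact n = 
          real (s n choose k) / real (n choose k) / fact k"
        using pos by (simp add: field_simps)
      \<comment> \<open>For \<open>s n < k\<close> both sides are 0, the product because of its
        factor at \<open>i = s n\<close>.\<close>
      also have "real (s n choose k) / real (n choose k) =
          (\<Prod>i = 0..<k. (real (s n) - real i) / (real n - real i))"
        by (simp add: binomial_gbinomial gbinomial_prod_rev prod_dividef)
      finally show ?case by simp
    qed
  qed
qed

text \<open>Monotonicity of binomials reduces the bound to s = n, where equality holds for k \<le>
  n; for k > n the binomial vanishes. Being uniform in \<open>n\<close>, the bound supplies the
  dominating series for Tannery's theorem.\<close>

lemma binomial_fact_quotient_le: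
  assumes "s \<le> n"
  shows "real (s choose k) * fact (n - k) / fact n \<le> 1 / fact k"
proof (cases "k \<le> n")
  case True
  have "real (s choose k) * (fact k * fact (n - k)) \<le> real (n choose k) * (fact k * fact (n - k))"
    using binomial_right_mono[OF assms, of k] by (intro mult_right_mono) auto
  also have "\<dots> = fact n"
    using arg_cong[OF binomial_fact_lemma[OF True], of real] by (simp add: mult_ac)
  finally show ?thesis by (simp add: field_simps)
next
  case False
  then show ?thesis using assms by (simp add: binomial_eq_0)
qed

text \<open>The binomials vanish beyond \<open>s n\<close>, so the sums of growing length are full
  series. Tannery's theorem, with the exponential series of \<bar>x\<bar> as majorant, then allows a
  termwise limit.\<close>

lemma tendsto_sum_binomial_fact_quotient:
  fixes t x :: real
  assumes lim: "(\<lambda>n. real (s n) / real n) \<longlonglongrightarrow> t" and le: "\<And>n. s n \<le> n"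
  shows "(\<lambda>n. \<Sum>k\<le>s n. real (s n choose k) * fact (n - k) / fact n * x ^ k) \<longlonglongrightarrow> exp (t * x)"
proof -
  let ?a = "\<lambda>k n. real (s n choose k) * fact (n - k) / fact n * x ^ k"
  have "(\<lambda>n. \<Sum>k. ?a k n) \<longlonglongrightarrow> (\<Sum>k. t ^ k / fact k * x ^ k)"
  proof (rule tannerys_theorem[THEN conjunct2, THEN conjunct2])
    show "(\<lambda>n. ?a k n) \<longlonglongrightarrow> t ^ k / fact k * x ^ k" for k
      by (intro tendsto_mult_right tendsto_binomial_fact_quotient lim)
    have "norm (?a k n) \<le> \<bar>x\<bar> ^ k / fact k" for k n
      using mult_right_mono[OF binomial_fact_quotient_le[OF le], of "\<bar>x\<bar> ^ k" n k]
      by (simp add: abs_mult power_abs)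
    then show "\<forall>\<^sub>F (k, n) in at_top \<times>\<^sub>F sequentially. norm (?a k n) \<le> \<bar>x\<bar> ^ k / fact k"
      by (intro always_eventually) auto
    show "summable (\<lambda>k. \<bar>x\<bar> ^ k / fact k)"
      using summable_exp[of "\<bar>x\<bar>"] by (simp add: field_simps)
  qed simp
  moreover have "(\<Sum>k. ?a k n) = (\<Sum>k\<le>s n. ?a k n)" for n
    by (rule suminf_finite) (auto simp: binomial_eq_0)
  moreover have "(\<Sum>k. t ^ k / fact k * x ^ k) = exp (t * x)"
    by (simp add: exp_def power_mult_distrib field_simps)
  ultimately show ?thesis by simp
qed

theorem theorem2p3:
  fixes t :: real
  assumes "0 < t" and "t \<le> 1"
  shows "prob_space (beta_measure t) \<and>
    weak_conv_m
      (\<lambda>n. distr (uniform_count_measure (hyperoctahedral_group n)) borel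
             (truncated_character (nat \<lfloor>t * real n\<rfloor>)))
      (beta_measure t)"
proof
  interpret beta: real_distribution "beta_measure t"
    using assms(1) by (rule real_distribution_beta_measure)
  show "prob_space (beta_measure t)" by (rule beta.prob_space_axioms)
  define s where "s n = nat \<lfloor>t * real n\<rfloor>" for n
  \<comment> \<open>Here t \<le> 1 enters: the truncated diagonal stays inside the matrix.\<close>
  have le: "s n \<le> n" for n
    using mult_right_mono[OF assms(2), of "real n"] by (simp add: s_def nat_le_iff floor_le_iff)
  have lim: "(\<lambda>n. real (s n) / real n) \<longlonglongrightarrow> t"
    unfolding s_def using assms(1) by (rule tendsto_floor_mult_div)
  have "weak_conv_m
      (\<lambda>n. distr (uniform_count_measure (hyperoctahedral_group n)) borel (truncated_character (s n)))
      (beta_measure t)"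
  proof (rule levy_continuity)
    show "real_distribution
        (distr (uniform_count_measure (hyperoctahedral_group n)) borel (truncated_character (s n)))" for n
      by (intro prob_space.real_distribution_distr prob_space_uniform_count_measure
          finite_hyperoctahedral_group hyperoctahedral_group_nonempty)
        (simp add: uniform_count_measure_def)
    show "real_distribution (beta_measure t)" by (rule beta.real_distribution_axioms)
    show "(\<lambda>n. char (distr (uniform_count_measure (hyperoctahedral_group n)) borel
          (truncated_character (s n))) \<theta>) \<longlonglongrightarrow> char (beta_measure t) \<theta>" for \<theta>
      \<comment> \<open>Both characteristic functions are real, so the claim is the preceding limit
        at x = cos \<theta> - 1.\<close>
      unfolding char_truncated_character[OF le] char_beta_measure[OF assms(1)] of_real_sum[symmetric]
      by (intro tendsto_of_real tendsto_sum_binomial_fact_quotient lim le)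
  qed
  then show "weak_conv_m
      (\<lambda>n. distr (uniform_count_measure (hyperoctahedral_group n)) borel
             (truncated_character (nat \<lfloor>t * real n\<rfloor>)))
      (beta_measure t)"
    by (simp only: s_def)
qed

end
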